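(* Let $(A,\prec,\succ,.)$ be a $\mathcal C$-tridendriform algebra. Then $(A,\prec,\succ,.)$ is a $\mathcal C$-NS-algebra (with the product $.$ playing the role of $\vee$).
   Context: Fix a commutative ring $R$; all modules, tensor products and linear maps are over $R$. An algebra $(A,\mu_1,\dots,\mu_s)$ is an $R$-module $A$ with linear maps (products) $\mu_i:A\otimes A\to A$; no associativity or unit is assumed. Fix a collection of multilinear relations $\mathcal R_1=0,\dots,\mathcal R_k=0$ in one binary product: an $n$-linear relation is an $R$-linear combination of parenthesized (non-associative) monomials in $x_1,\dots,x_n$, each variable occurring exactly once in each monomial. $\mathcal C$ is the category of all algebras $(A,\mu)$ with one product in which these relations hold for all substitutions of elements of $A$; $(A,\mu)\in\mathcal C$ means that $(A,\mu)$ satisfies all of them. $\mathcal C$-tridendriform algebra: an algebra $(A,\prec,\succ,.)$ with three products such that $(A\oplus A,\boxtimes)\in\mathcal C$, where $(a,x)\boxtimes(a',x'):=(a\star a',\,a\succ x'+x\prec a'+x.x')$ and $a\star a':=a\succ a'+a\prec a'+a.a'$. $\mathcal C$-NS-algebra: an algebra $(A,\prec,\succ,\vee)$ with three products such that $(A\oplus A,\boxtimes)\in\mathcal C$, where now $(a,x)\boxtimes(a',x'):=(a\star a',\,a\succ x'+x\prec a')$ and $a\star a':=a\succ a'+a\prec a'+a\vee a'$. *)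

theory Defs
  imports "HOL-Algebra.Algebra"
begin

text \<open>
  A product on a module is a binary operation next to the module record. A linear map from the
  tensor square of the module to the module is given by the corresponding bilinear map. The
  multiplication and unit components of the module record itself are never used.
\<close>

definition bilinear_product ::
    "('r, 'n) ring_scheme \<Rightarrow> ('r, 'a, 'm) module_scheme \<Rightarrow> ('a \<Rightarrow> 'a \<Rightarrow> 'a) \<Rightarrow> bool" where
  "bilinear_product R A \<mu> \<longleftrightarrow>
     (\<forall>a\<in>carrier A. \<forall>b\<in>carrier A. \<mu> a b \<in> carrier A) \<and>
     (\<forall>a\<in>carrier A. \<forall>a'\<in>carrier A. \<forall>b\<in>carrier A. \<mu> (a \<oplus>\<^bsub>A\<^esub> a') b = \<mu> a b \<oplus>\<^bsub>A\<^esub> \<mu> a' b) \<and>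
     (\<forall>a\<in>carrier A. \<forall>b\<in>carrier A. \<forall>b'\<in>carrier A. \<mu> a (b \<oplus>\<^bsub>A\<^esub> b') = \<mu> a b \<oplus>\<^bsub>A\<^esub> \<mu> a b') \<and>
     (\<forall>r\<in>carrier R. \<forall>a\<in>carrier A. \<forall>b\<in>carrier A. \<mu> (r \<odot>\<^bsub>A\<^esub> a) b = r \<odot>\<^bsub>A\<^esub> \<mu> a b) \<and>
     (\<forall>r\<in>carrier R. \<forall>a\<in>carrier A. \<forall>b\<in>carrier A. \<mu> a (r \<odot>\<^bsub>A\<^esub> b) = r \<odot>\<^bsub>A\<^esub> \<mu> a b)"

definition nonassoc_algebra ::
    "('r, 'n) ring_scheme \<Rightarrow> ('r, 'a, 'm) module_scheme \<Rightarrow> ('a \<Rightarrow> 'a \<Rightarrow> 'a) list \<Rightarrow> bool" where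
  "nonassoc_algebra R A \<mu>s \<longleftrightarrow> module R A \<and> (\<forall>\<mu>\<in>set \<mu>s. bilinear_product R A \<mu>)"

datatype monomial = Var nat | Mul monomial monomial

primrec vars :: "monomial \<Rightarrow> nat list" where
  "vars (Var i) = [i]"
| "vars (Mul s t) = vars s @ vars t"

primrec interp :: "('a \<Rightarrow> 'a \<Rightarrow> 'a) \<Rightarrow> (nat \<Rightarrow> 'a) \<Rightarrow> monomial \<Rightarrow> 'a" where
  "interp \<mu> x (Var i) = x i"
| "interp \<mu> x (Mul s t) = \<mu> (interp \<mu> x s) (interp \<mu> x t)"

text \<open>A relation is a formal linear combination, listed as its (coefficient, monomial) terms.\<close>

type_synonym 'r relation = "('r \<times> monomial) list"

definition multilinear :: "('r, 'n) ring_scheme \<Rightarrow> nat \<Rightarrow> 'r relation \<Rightarrow> bool" where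
  "multilinear R n \<rho> \<longleftrightarrow>
     (\<forall>(c, t)\<in>set \<rho>. c \<in> carrier R \<and> distinct (vars t) \<and> set (vars t) = {1..n})"

definition relation_value ::
    "('r, 'a, 'm) module_scheme \<Rightarrow> ('a \<Rightarrow> 'a \<Rightarrow> 'a) \<Rightarrow> (nat \<Rightarrow> 'a) \<Rightarrow> 'r relation \<Rightarrow> 'a" where
  "relation_value A \<mu> x \<rho> = foldr (\<lambda>(c, t) s. c \<odot>\<^bsub>A\<^esub> interp \<mu> x t \<oplus>\<^bsub>A\<^esub> s) \<rho> \<zero>\<^bsub>A\<^esub>"

text \<open>The category determined by the list of relations \<open>\<R>\<close>; only its objects are needed.\<close>

definition in_category ::
    "('r, 'n) ring_scheme \<Rightarrow> 'r relation list \<Rightarrow> ('r, 'a, 'm) module_scheme \<Rightarrow>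
     ('a \<Rightarrow> 'a \<Rightarrow> 'a) \<Rightarrow> bool" where
  "in_category R \<R> A \<mu> \<longleftrightarrow>
     nonassoc_algebra R A [\<mu>] \<and>
     (\<forall>\<rho>\<in>set \<R>. \<forall>x. (\<forall>i. x i \<in> carrier A) \<longrightarrow> relation_value A \<mu> x \<rho> = \<zero>\<^bsub>A\<^esub>)"

definition direct_sum ::
    "('r, 'a, 'm) module_scheme \<Rightarrow> ('r, 'b, 'k) module_scheme \<Rightarrow> ('r, 'a \<times> 'b) module" where
  "direct_sum M N =
     ring.extend (RDirProd M N) (module.fields (\<lambda>r (a, b). (r \<odot>\<^bsub>M\<^esub> a, r \<odot>\<^bsub>N\<^esub> b)))"

text \<open>Below, \<open>lt\<close> and \<open>gt\<close> stand for the products \<open>\<prec>\<close> and \<open>\<succ>\<close>.\<close>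

definition star ::
    "('r, 'a, 'm) module_scheme \<Rightarrow> ('a \<Rightarrow> 'a \<Rightarrow> 'a) \<Rightarrow> ('a \<Rightarrow> 'a \<Rightarrow> 'a) \<Rightarrow> ('a \<Rightarrow> 'a \<Rightarrow> 'a) \<Rightarrow>
     'a \<Rightarrow> 'a \<Rightarrow> 'a" where
  "star A lt gt third a a' = gt a a' \<oplus>\<^bsub>A\<^esub> lt a a' \<oplus>\<^bsub>A\<^esub> third a a'"

definition tridendriform_box ::
    "('r, 'a, 'm) module_scheme \<Rightarrow> ('a \<Rightarrow> 'a \<Rightarrow> 'a) \<Rightarrow> ('a \<Rightarrow> 'a \<Rightarrow> 'a) \<Rightarrow> ('a \<Rightarrow> 'a \<Rightarrow> 'a) \<Rightarrow>
     'a \<times> 'a \<Rightarrow> 'a \<times> 'a \<Rightarrow> 'a \<times> 'a" where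
  "tridendriform_box A lt gt dot = (\<lambda>(a, x) (a', x').
     (star A lt gt dot a a', gt a x' \<oplus>\<^bsub>A\<^esub> lt x a' \<oplus>\<^bsub>A\<^esub> dot x x'))"

definition NS_box ::
    "('r, 'a, 'm) module_scheme \<Rightarrow> ('a \<Rightarrow> 'a \<Rightarrow> 'a) \<Rightarrow> ('a \<Rightarrow> 'a \<Rightarrow> 'a) \<Rightarrow> ('a \<Rightarrow> 'a \<Rightarrow> 'a) \<Rightarrow>
     'a \<times> 'a \<Rightarrow> 'a \<times> 'a \<Rightarrow> 'a \<times> 'a" where
  "NS_box A lt gt vee = (\<lambda>(a, x) (a', x').
     (star A lt gt vee a a', gt a x' \<oplus>\<^bsub>A\<^esub> lt x a'))"

definition tridendriform_algebra ::
    "('r, 'n) ring_scheme \<Rightarrow> 'r relation list \<Rightarrow> ('r, 'a, 'm) module_scheme \<Rightarrow>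
     ('a \<Rightarrow> 'a \<Rightarrow> 'a) \<Rightarrow> ('a \<Rightarrow> 'a \<Rightarrow> 'a) \<Rightarrow> ('a \<Rightarrow> 'a \<Rightarrow> 'a) \<Rightarrow> bool" where
  "tridendriform_algebra R \<R> A lt gt dot \<longleftrightarrow>
     nonassoc_algebra R A [lt, gt, dot] \<and>
     in_category R \<R> (direct_sum A A) (tridendriform_box A lt gt dot)"

definition NS_algebra ::
    "('r, 'n) ring_scheme \<Rightarrow> 'r relation list \<Rightarrow> ('r, 'a, 'm) module_scheme \<Rightarrow>
     ('a \<Rightarrow> 'a \<Rightarrow> 'a) \<Rightarrow> ('a \<Rightarrow> 'a \<Rightarrow> 'a) \<Rightarrow> ('a \<Rightarrow> 'a \<Rightarrow> 'a) \<Rightarrow> bool" where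
  "NS_algebra R \<R> A lt gt vee \<longleftrightarrow>
     nonassoc_algebra R A [lt, gt, vee] \<and>
     in_category R \<R> (direct_sum A A) (NS_box A lt gt vee)"

end

theory Submission
  imports Defs
begin

text \<open>
  The second component of an NS-monomial at the points \<open>(a\<^sub>i, x\<^sub>i)\<close> is additive in
  \<open>x\<close>. When \<open>x\<close> is supported at a single index, every term containing a product
  \<open>x . x'\<close> vanishes in a monomial that is linear in each variable, so NS-monomials and
  tridendriform monomials agree there; hence the relations hold at such points. Adding up these
  points over all the indices gives the relations at an arbitrary \<open>x\<close>.
\<close>

lemma direct_sum_simps [simp]:
  "carrier (direct_sum M N) = carrier M \<times> carrier N"
  "\<zero>\<^bsub>direct_sum M N\<^esub> = (\<zero>\<^bsub>M\<^esub>, \<zero>\<^bsub>N\<^esub>)"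
  "p \<oplus>\<^bsub>direct_sum M N\<^esub> q = (fst p \<oplus>\<^bsub>M\<^esub> fst q, snd p \<oplus>\<^bsub>N\<^esub> snd q)"
  "c \<odot>\<^bsub>direct_sum M N\<^esub> p = (c \<odot>\<^bsub>M\<^esub> fst p, c \<odot>\<^bsub>N\<^esub> snd p)"
  by (simp_all add: direct_sum_def RDirProd_def DirProd_def ring.defs monoid.defs module.defs split_def)

lemma interp_cong:
  "(\<And>i. i \<in> set (vars t) \<Longrightarrow> x i = y i) \<Longrightarrow> interp \<mu> x t = interp \<mu> y t"
  by (induction t) auto

lemma interp_closed:
  assumes "\<And>a b. a \<in> C \<Longrightarrow> b \<in> C \<Longrightarrow> \<mu> a b \<in> C" and "\<And>i. x i \<in> C"
  shows "interp \<mu> x t \<in> C"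
  using assms by (induction t) auto

lemma relation_value_simps [simp]:
  "relation_value A \<mu> x [] = \<zero>\<^bsub>A\<^esub>"
  "relation_value A \<mu> x ((c, t) # \<rho>) = c \<odot>\<^bsub>A\<^esub> interp \<mu> x t \<oplus>\<^bsub>A\<^esub> relation_value A \<mu> x \<rho>"
  by (simp_all add: relation_value_def)

lemma relation_value_cong:
  "(\<And>c t. (c, t) \<in> set \<rho> \<Longrightarrow> interp \<mu> x t = interp \<nu> y t) \<Longrightarrow>
    relation_value A \<mu> x \<rho> = relation_value A \<nu> y \<rho>"
  by (induction \<rho>) force+

text \<open>Addition and scalar multiplication in a direct sum are componentwise, so agreement of
  the first components of the monomials suffices. This form is needed because the NS and
  tridendriform boxes agree in general only in the first component.\<close>

lemma fst_relation_value_cong: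
  "(\<And>c t. (c, t) \<in> set \<rho> \<Longrightarrow> fst (interp \<mu> x t) = fst (interp \<nu> y t)) \<Longrightarrow>
    fst (relation_value (direct_sum M N) \<mu> x \<rho>) = fst (relation_value (direct_sum M N) \<nu> y \<rho>)"
  by (induction \<rho>) force+

text \<open>Only bilinearity is fixed here, so the computations with monomials do not depend on the
  category; relations enter first in \<open>relation_value_NS_zero\<close>.\<close>

locale module_with_products = module R A
  for R :: "('r, 'n) ring_scheme" (structure) and A :: "('r, 'a, 'm) module_scheme" (structure) +
  fixes lt gt dot :: "'a \<Rightarrow> 'a \<Rightarrow> 'a"
  assumes lt: "bilinear_product R A lt"
    and gt: "bilinear_product R A gt"
    and dot: "bilinear_product R A dot"
begin

abbreviation "C \<equiv> carrier A"
abbreviation "tri \<equiv> tridendriform_box A lt gt dot"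
abbreviation "NS \<equiv> NS_box A lt gt dot"

lemma bilinear_closed:
  "\<lbrakk>bilinear_product R A \<mu>; a \<in> C; b \<in> C\<rbrakk> \<Longrightarrow> \<mu> a b \<in> C"
  by (simp add: bilinear_product_def)

lemma bilinear_add:
  assumes "bilinear_product R A \<mu>" "a \<in> C" "a' \<in> C" "b \<in> C"
  shows "\<mu> (a \<oplus>\<^bsub>A\<^esub> a') b = \<mu> a b \<oplus>\<^bsub>A\<^esub> \<mu> a' b" "\<mu> b (a \<oplus>\<^bsub>A\<^esub> a') = \<mu> b a \<oplus>\<^bsub>A\<^esub> \<mu> b a'"
  using assms by (simp_all add: bilinear_product_def)

lemma bilinear_smult:
  assumes "bilinear_product R A \<mu>" "r \<in> carrier R" "a \<in> C" "b \<in> C"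
  shows "\<mu> (r \<odot>\<^bsub>A\<^esub> a) b = r \<odot>\<^bsub>A\<^esub> \<mu> a b" "\<mu> a (r \<odot>\<^bsub>A\<^esub> b) = r \<odot>\<^bsub>A\<^esub> \<mu> a b"
  using assms by (simp_all add: bilinear_product_def)

lemma bilinear_zero:
  assumes "bilinear_product R A \<mu>" "a \<in> C"
  shows "\<mu> \<zero>\<^bsub>A\<^esub> a = \<zero>\<^bsub>A\<^esub>" "\<mu> a \<zero>\<^bsub>A\<^esub> = \<zero>\<^bsub>A\<^esub>"
  \<comment> \<open>Write the zero vector as the scalar zero times itself and pull the scalar out of
    the product.\<close>
  using bilinear_smult[OF assms(1), of \<zero> "\<zero>\<^bsub>A\<^esub>" a] bilinear_smult[OF assms(1), of \<zero> a "\<zero>\<^bsub>A\<^esub>"]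
    assms bilinear_closed
  by simp_all

lemmas product_closed = bilinear_closed[OF lt] bilinear_closed[OF gt] bilinear_closed[OF dot]
lemmas product_add = bilinear_add[OF lt] bilinear_add[OF gt] bilinear_add[OF dot]
lemmas product_smult = bilinear_smult[OF lt] bilinear_smult[OF gt] bilinear_smult[OF dot]
lemmas product_zero = bilinear_zero[OF lt] bilinear_zero[OF gt] bilinear_zero[OF dot]

lemma fst_box [simp]:
  "fst (tri p q) = star A lt gt dot (fst p) (fst q)"
  "fst (NS p q) = star A lt gt dot (fst p) (fst q)"
  by (simp_all add: tridendriform_box_def NS_box_def split_def)

lemma snd_box [simp]:
  "snd (tri p q) = gt (fst p) (snd q) \<oplus>\<^bsub>A\<^esub> lt (snd p) (fst q) \<oplus>\<^bsub>A\<^esub> dot (snd p) (snd q)"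
  "snd (NS p q) = gt (fst p) (snd q) \<oplus>\<^bsub>A\<^esub> lt (snd p) (fst q)"
  by (simp_all add: tridendriform_box_def NS_box_def split_def)

lemma bilinear_NS_box: "bilinear_product R (direct_sum A A) NS"
  unfolding bilinear_product_def
  by (auto simp: prod_eq_iff mem_Times_iff star_def product_closed product_add product_smult
      smult_r_distr M.a_ac)

lemma interp_NS_closed:
  assumes "\<And>i. z i \<in> C \<times> C"
  shows "interp NS z t \<in> C \<times> C"
  by (rule interp_closed) (use assms in \<open>auto simp: mem_Times_iff star_def product_closed\<close>)

text \<open>Both boxes act on first components by the same \<open>star\<close>, which never sees a
  second component.\<close>

lemma fst_interp_NS: "fst (interp NS z t) = fst (interp tri z t)"
  by (induction t) auto

lemma fst_interp_NS_cong:
  "(\<And>i. fst (z i) = fst (w i)) \<Longrightarrow> fst (interp NS z t) = fst (interp NS w t)"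
  by (induction t) auto

text \<open>Each summand in the second component of the NS box contains exactly one second
  component, so it is additive in these once the first components are fixed. A term
  \<open>dot x x'\<close> would create cross terms.\<close>

lemma snd_interp_NS_add:
  assumes "\<And>i. a i \<in> C" "\<And>i. x i \<in> C" "\<And>i. y i \<in> C"
  shows "snd (interp NS (\<lambda>i. (a i, x i \<oplus>\<^bsub>A\<^esub> y i)) t) =
    snd (interp NS (\<lambda>i. (a i, x i)) t) \<oplus>\<^bsub>A\<^esub> snd (interp NS (\<lambda>i. (a i, y i)) t)"
proof (induction t)
  case (Mul s t)
  have c: "interp NS (\<lambda>i. (a i, x i)) u \<in> C \<times> C" "interp NS (\<lambda>i. (a i, y i)) u \<in> C \<times> C" for u
    by (rule interp_NS_closed, simp add: assms)+
  \<comment> \<open>The three evaluations share their first components, so additivity is applied in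
    one argument of \<open>gt\<close> or \<open>lt\<close> with the other argument common to
    all.\<close>
  have f: "fst (interp NS (\<lambda>i. (a i, x i \<oplus>\<^bsub>A\<^esub> y i)) u) = fst (interp NS (\<lambda>i. (a i, x i)) u)"
    "fst (interp NS (\<lambda>i. (a i, y i)) u) = fst (interp NS (\<lambda>i. (a i, x i)) u)" for u
    by (rule fst_interp_NS_cong, simp)+
  show ?case
    using c[of s] c[of t] Mul.IH f
    by (simp add: mem_Times_iff product_add product_closed M.a_ac)
qed simp

lemma snd_interp_NS_zero:
  assumes "\<And>i. z i \<in> C \<times> C" "\<And>i. i \<in> set (vars t) \<Longrightarrow> snd (z i) = \<zero>\<^bsub>A\<^esub>"
  shows "snd (interp NS z t) = \<zero>\<^bsub>A\<^esub>"
  using assms(2)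
proof (induction t)
  case (Mul s t)
  then show ?case
    using interp_NS_closed[OF assms(1), where t = s] interp_NS_closed[OF assms(1), where t = t]
    by (simp add: mem_Times_iff product_zero)
qed auto

text \<open>The boxes differ only by \<open>dot\<close> of the two second components. In a monomial
  without repeated variables \<open>j\<close> misses one factor of each product, and that factor has
  second component zero.\<close>

lemma interp_NS_eq_tri:
  assumes "\<And>i. z i \<in> C \<times> C" "\<And>i. i \<noteq> j \<Longrightarrow> snd (z i) = \<zero>\<^bsub>A\<^esub>" "distinct (vars t)"
  shows "interp NS z t = interp tri z t"
  using assms(3)
proof (induction t)
  case (Mul s t)
  have c: "interp NS z s \<in> C \<times> C" "interp NS z t \<in> C \<times> C"
    by (rule interp_NS_closed, rule assms(1))+
  have "j \<notin> set (vars s) \<or> j \<notin> set (vars t)"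
    using Mul.prems by auto
  then have "snd (interp NS z s) = \<zero>\<^bsub>A\<^esub> \<or> snd (interp NS z t) = \<zero>\<^bsub>A\<^esub>"
    by (metis snd_interp_NS_zero assms(1,2))
  then have "NS (interp NS z s) (interp NS z t) = tri (interp NS z s) (interp NS z t)"
    using c by (auto simp: prod_eq_iff mem_Times_iff product_zero product_closed)
  then show ?case
    using Mul by simp
qed simp

lemma relation_value_NS_closed:
  assumes "fst ` set \<rho> \<subseteq> carrier R" "\<And>i. z i \<in> C \<times> C"
  shows "relation_value (direct_sum A A) NS z \<rho> \<in> C \<times> C"
  using assms(1)
proof (induction \<rho>)
  case (Cons q \<rho>)
  then show ?case
    using interp_NS_closed[OF assms(2), where t = "snd q"] by (cases q) (auto simp: mem_Times_iff)
qed simp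

lemma snd_relation_value_NS_add:
  assumes "fst ` set \<rho> \<subseteq> carrier R" "\<And>i. a i \<in> C" "\<And>i. x i \<in> C" "\<And>i. y i \<in> C"
  shows "snd (relation_value (direct_sum A A) NS (\<lambda>i. (a i, x i \<oplus>\<^bsub>A\<^esub> y i)) \<rho>) =
    snd (relation_value (direct_sum A A) NS (\<lambda>i. (a i, x i)) \<rho>) \<oplus>\<^bsub>A\<^esub>
    snd (relation_value (direct_sum A A) NS (\<lambda>i. (a i, y i)) \<rho>)"
  using assms(1)
proof (induction \<rho>)
  case (Cons q \<rho>)
  obtain c t where q: "q = (c, t)" by fastforce
  have "interp NS (\<lambda>i. (a i, w i)) t \<in> C \<times> C"
    "relation_value (direct_sum A A) NS (\<lambda>i. (a i, w i)) \<rho> \<in> C \<times> C" if "\<And>i. w i \<in> C" for w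
    using that Cons.prems assms by (auto intro!: interp_NS_closed relation_value_NS_closed)
  from this[of x] this[of y] assms Cons show ?case
    by (simp add: q snd_interp_NS_add mem_Times_iff smult_r_distr M.a_ac)
qed simp

lemma relation_value_NS_zero:
  assumes \<rho>: "multilinear R n \<rho>"
    and tri: "\<And>z. (\<And>i. z i \<in> C \<times> C) \<Longrightarrow> relation_value (direct_sum A A) tri z \<rho> = (\<zero>\<^bsub>A\<^esub>, \<zero>\<^bsub>A\<^esub>)"
    and z: "\<And>i. z i \<in> C \<times> C"
  shows "relation_value (direct_sum A A) NS z \<rho> = (\<zero>\<^bsub>A\<^esub>, \<zero>\<^bsub>A\<^esub>)"
proof -
  define a x where "a i = fst (z i)" and "x i = snd (z i)" for i
  have ax: "a i \<in> C" "x i \<in> C" for i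
    using z[of i] by (auto simp: a_def x_def)
  have coeffs: "fst ` set \<rho> \<subseteq> carrier R"
    using \<rho> by (auto simp: multilinear_def)
  \<comment> \<open>Cut \<open>x\<close> down to the indices in \<open>J\<close> and keep all of
    \<open>a\<close>; \<open>val J\<close> will be shown to vanish by adding one index at a
    time.\<close>
  define w where "w J i = (if i \<in> J then x i else \<zero>\<^bsub>A\<^esub>)" for J i
  have w: "w J i \<in> C" for J i
    by (simp add: w_def ax)
  define val where "val J = snd (relation_value (direct_sum A A) NS (\<lambda>i. (a i, w J i)) \<rho>)" for J
  \<comment> \<open>Inclusion instead of equality lets this also serve as the base case
    \<open>J = {}\<close> of the induction.\<close>
  have single: "val J = \<zero>\<^bsub>A\<^esub>" if j: "J \<subseteq> {j}" for J j
  proof -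
    have "relation_value (direct_sum A A) NS (\<lambda>i. (a i, w J i)) \<rho> =
        relation_value (direct_sum A A) tri (\<lambda>i. (a i, w J i)) \<rho>"
      by (intro relation_value_cong interp_NS_eq_tri[where j = j])
        (use \<rho> j ax w in \<open>auto simp: multilinear_def w_def\<close>)
    then show ?thesis
      using tri ax w by (simp add: val_def)
  qed
  have "val J = \<zero>\<^bsub>A\<^esub>" if "finite J" for J
    using that
  proof (induction J)
    case empty
    show ?case
      by (rule single) (rule empty_subsetI)
  next
    case (insert j J)
    \<comment> \<open>Since \<open>j\<close> lies outside \<open>J\<close>, at most one summand is
      nonzero at each index.\<close>
    have "w (insert j J) = (\<lambda>i. w {j} i \<oplus>\<^bsub>A\<^esub> w J i)"
      using insert.hyps ax by (auto simp: w_def)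
    then have "val (insert j J) = val {j} \<oplus>\<^bsub>A\<^esub> val J"
      using snd_relation_value_NS_add[OF coeffs, of a "w {j}" "w J"] ax w by (simp add: val_def)
    then show ?case
      by (simp add: single[of "{j}" j] insert.IH)
  qed
  then have "val {1..n} = \<zero>\<^bsub>A\<^esub>"
    by simp
  \<comment> \<open>The monomials involve only the variables \<open>1\<close> to \<open>n\<close>,
    so cutting off \<open>x\<close> elsewhere changes nothing and a finite \<open>J\<close> is
    enough.\<close>
  moreover have "relation_value (direct_sum A A) NS z \<rho> =
      relation_value (direct_sum A A) NS (\<lambda>i. (a i, w {1..n} i)) \<rho>"
    by (intro relation_value_cong interp_cong)
      (use \<rho> in \<open>auto simp: multilinear_def a_def x_def w_def\<close>)
  \<comment> \<open>The first component needs no decomposition: it equals the tridendriform one at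
    the same point \<open>z\<close>.\<close>
  moreover have "fst (relation_value (direct_sum A A) NS z \<rho>) =
      fst (relation_value (direct_sum A A) tri z \<rho>)"
    by (rule fst_relation_value_cong) (rule fst_interp_NS)
  ultimately show ?thesis
    using tri[of z] z by (simp add: prod_eq_iff val_def)
qed

end

theorem proposition3p9:
  fixes R :: "('r, 'n) ring_scheme"
    and \<R> :: "'r relation list"
    and A :: "('r, 'a, 'm) module_scheme"
    and lt gt dot :: "'a \<Rightarrow> 'a \<Rightarrow> 'a"
  assumes "cring R"
    and "\<And>\<rho>. \<rho> \<in> set \<R> \<Longrightarrow> \<exists>n. multilinear R n \<rho>"
    and "tridendriform_algebra R \<R> A lt gt dot"
  shows "NS_algebra R \<R> A lt gt dot"
proof -
  have alg: "nonassoc_algebra R A [lt, gt, dot]"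
    and cat: "in_category R \<R> (direct_sum A A) (tridendriform_box A lt gt dot)"
    using assms(3) by (simp_all add: tridendriform_algebra_def)
  interpret module R A
    using alg by (simp add: nonassoc_algebra_def)
  interpret module_with_products R A lt gt dot
    by unfold_locales (use alg in \<open>simp_all add: nonassoc_algebra_def\<close>)
  have "relation_value (direct_sum A A) NS z \<rho> = (\<zero>\<^bsub>A\<^esub>, \<zero>\<^bsub>A\<^esub>)"
    if "\<rho> \<in> set \<R>" "\<And>i. z i \<in> C \<times> C" for \<rho> z
  proof -
    obtain n where "multilinear R n \<rho>"
      using assms(2) \<open>\<rho> \<in> set \<R>\<close> by blast
    then show ?thesis
      by (rule relation_value_NS_zero) (use cat that in \<open>simp_all add: in_category_def\<close>)
  qed
  \<comment> \<open>That the direct sum is a module is read off from \<open>cat\<close>; bilinearity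
    of the new product is \<open>bilinear_NS_box\<close>.\<close>
  then show ?thesis
    using alg cat bilinear_NS_box
    by (simp add: NS_algebra_def in_category_def nonassoc_algebra_def)
qed

end
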